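(* Define natural numbers $n_0:=0$ and, for $k\ge 0$, $$n_{k+1} := n_k + 2^{\,k\sum_{i\le k} i},$$ where $\sum_{i\le k} i = 0+1+\dots+k$, and let $N:=\{n_k : k\ge 1\}$. Let $\mu := \prod_{n=0}^\infty m_n$ be the product probability measure on $2^{\mathbb{N}}$ whose marginals $m_n$ on $\{0,1\}$ are given by $$m_{n_k}(0)=\frac{1}{2^k+1},\qquad m_{n_k}(1)=\frac{2^k}{2^k+1}\qquad\text{for } k\ge 1,$$ and $m_n(0)=m_n(1)=\tfrac12$ for $n\notin N$. Let $X\subseteq 2^{\mathbb{N}}$ be the set of binary sequences with infinitely many $1$s, let $f:X\to X$ be the least-deletion map, let $E_f$ be its orbit equivalence relation, and let $\mathfrak{w}$ be the Radon--Nikodym cocycle of $E_f$ with respect to $\mu$. Then $\mathfrak{w}$ vanishes nonsummably along the forward geodesic of $f$ almost everywhere: for $\mu$-a.e. $x\in X$, $$\lim_{k\to\infty}\mathfrak{w}_x(f^k(x)) = 0\quad\text{and}\quad \sum_{k\in\mathbb{N}}\mathfrak{w}_x(f^k(x))=\infty.$$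
   Context: Sequences in $2^{\mathbb{N}}=\{0,1\}^{\mathbb{N}}$ are written $x=(x_0,x_1,x_2,\dots)$. $X$ denotes the set of $x\in 2^{\mathbb{N}}$ with infinitely many $1$s. The least-deletion map $f:X\to X$ changes the first $1$ of $x$ to $0$ and leaves all other bits unchanged. The orbit equivalence relation $E_f$ on $X$ is: $x\,E_f\,y$ iff $f^a(x)=f^b(y)$ for some $a,b\ge 0$; it coincides with eventual equality on $X$. The forward geodesic of $x$ is $(x,f(x),f^2(x),\dots)$. A countable Borel equivalence relation $E$ on a standard Borel space $X$ is an equivalence relation with countable classes that is a Borel subset of $X\times X$. A measure $\mu$ is $E$-quasi-invariant if the $E$-saturation of every $\mu$-null set is $\mu$-null. Every product measure on $2^{\mathbb{N}}$ whose marginals are non-trivial (give positive mass to both $0$ and $1$) is $E_f$-quasi-invariant (restricted to $X$). Radon--Nikodym cocycle: if $\mu$ is $E$-quasi-invariant, there is a Borel map $\mathfrak{w}:E\to\mathbb{R}^+=(0,\infty)$, unique up to null sets, with $\mathfrak{w}_x(y)$ (for $x\,E\,y$) thought of as the weight of $y$ relative to $x$, satisfying the cocycle identity $\mathfrak{w}_x(z)=\mathfrak{w}_x(y)\,\mathfrak{w}_y(z)$ and the tilted mass transport principle: for every Borel partial bijection $\gamma$ between Borel subsets of $X$ with $\gamma(x)\,E\,x$ for all $x\in\mathrm{dom}(\gamma)$, and every $\varphi\in L^1(X,\mu)$, $$\int_{\mathrm{im}(\gamma)}\varphi(x)\,d\mu(x)=\int_{\mathrm{dom}(\gamma)}\varphi(\gamma(x))\,\mathfrak{w}_x(\gamma(x))\,d\mu(x).$$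 *)

theory Defs
  imports "HOL-Probability.Probability"
begin

section \<open>Radon--Nikodym cocycles\<close>

text \<open>A Borel space \<open>X\<close> with a measure on it is given as a single measure \<open>M\<close> with
  \<open>space M = X\<close>. The weight \<open>w x y\<close> of \<open>y\<close> relative to \<open>x\<close> is constrained only for
  \<open>(x, y) \<in> E\<close>. The cocycle is unique only up to null sets, hence a predicate.
  Integrability of the right-hand side of the mass transport identity is stated explicitly because
  the integral of a non-integrable function is \<open>0\<close> by convention.\<close>

definition tilted_mass_transport ::
  "'a measure \<Rightarrow> ('a \<times> 'a) set \<Rightarrow> ('a \<Rightarrow> 'a \<Rightarrow> real) \<Rightarrow> bool" where
  "tilted_mass_transport M E w \<longleftrightarrow>
     (\<forall>A B \<gamma> \<phi>. A \<in> sets M \<longrightarrow> B \<in> sets M \<longrightarrow>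
        \<gamma> \<in> restrict_space M A \<rightarrow>\<^sub>M M \<longrightarrow> bij_betw \<gamma> A B \<longrightarrow> (\<forall>x\<in>A. (\<gamma> x, x) \<in> E) \<longrightarrow>
        integrable M (\<phi> :: 'a \<Rightarrow> real) \<longrightarrow>
        set_integrable M A (\<lambda>x. \<phi> (\<gamma> x) * w x (\<gamma> x)) \<and>
        (LINT x:B|M. \<phi> x) = (LINT x:A|M. \<phi> (\<gamma> x) * w x (\<gamma> x)))"

definition radon_nikodym_cocycle ::
  "'a measure \<Rightarrow> ('a \<times> 'a) set \<Rightarrow> ('a \<Rightarrow> 'a \<Rightarrow> real) \<Rightarrow> bool" where
  "radon_nikodym_cocycle M E w \<longleftrightarrow>
     (\<lambda>(x, y). w x y) \<in> borel_measurable (restrict_space (M \<Otimes>\<^sub>M M) E) \<and>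
     (\<forall>(x, y)\<in>E. 0 < w x y) \<and>
     (\<forall>x y z. (x, y) \<in> E \<longrightarrow> (y, z) \<in> E \<longrightarrow> w x z = w x y * w y z) \<and>
     tilted_mass_transport M E w"

section \<open>The least-deletion map\<close>

text \<open>Binary sequences are functions \<open>nat \<Rightarrow> bool\<close>, with \<open>True\<close> for the bit 1.\<close>

definition inf_ones :: "(nat \<Rightarrow> bool) set" where
  "inf_ones = {x. infinite {n. x n}}"

definition least_deletion :: "(nat \<Rightarrow> bool) \<Rightarrow> (nat \<Rightarrow> bool)" where
  "least_deletion x = x((LEAST n. x n) := False)"

lemma least_deletion_in_inf_ones:
  assumes "x \<in> inf_ones"
  shows "least_deletion x \<in> inf_ones"
proof -
  have "{n. least_deletion x n} = {n. x n} - {LEAST n. x n}"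
    by (auto simp: least_deletion_def)
  then show ?thesis
    using assms by (simp add: inf_ones_def)
qed

definition orbit_equiv :: "'a set \<Rightarrow> ('a \<Rightarrow> 'a) \<Rightarrow> ('a \<times> 'a) set" where
  "orbit_equiv X f = {(x, y). x \<in> X \<and> y \<in> X \<and> (\<exists>a b. (f ^^ a) x = (f ^^ b) y)}"

section \<open>The product measure\<close>

primrec nseq :: "nat \<Rightarrow> nat" where
  "nseq 0 = 0"
| "nseq (Suc k) = nseq k + 2 ^ (k * (\<Sum>i\<le>k. i))"

definition Nset :: "nat set" where
  "Nset = {nseq k | k. 1 \<le> k}"

definition marginal :: "nat \<Rightarrow> bool pmf" where
  "marginal n = bernoulli_pmf
     (if n \<in> Nset then let k = (THE k. 1 \<le> k \<and> nseq k = n) in 2 ^ k / (2 ^ k + 1) else 1 / 2)"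

lemma strict_mono_nseq: "strict_mono nseq"
  by (simp add: strict_mono_Suc_iff)

lemma marginal_nseq:
  assumes "1 \<le> k"
  shows "pmf (marginal (nseq k)) False = 1 / (2 ^ k + 1)"
    and "pmf (marginal (nseq k)) True = 2 ^ k / (2 ^ k + 1)"
proof -
  have "(THE j. 1 \<le> j \<and> nseq j = nseq k) = k"
    using assms strict_mono_eq[OF strict_mono_nseq] by (intro the_equality) auto
  moreover have "nseq k \<in> Nset"
    using assms by (auto simp: Nset_def)
  ultimately have m: "marginal (nseq k) = bernoulli_pmf (2 ^ k / (2 ^ k + 1))"
    by (simp add: marginal_def Let_def)
  have pos: "0 < (2 ^ k + 1 :: real)"
    by (simp add: add_pos_pos)
  then have le: "0 \<le> (2 ^ k / (2 ^ k + 1) :: real)" "(2 ^ k / (2 ^ k + 1) :: real) \<le> 1"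
    by (simp_all add: divide_simps)
  show "pmf (marginal (nseq k)) True = 2 ^ k / (2 ^ k + 1)"
    using le by (simp add: m)
  show "pmf (marginal (nseq k)) False = 1 / (2 ^ k + 1)"
    using le pos by (simp add: m field_simps)
qed

lemma marginal_notin:
  assumes "n \<notin> Nset"
  shows "pmf (marginal n) False = 1 / 2" and "pmf (marginal n) True = 1 / 2"
  using assms by (simp_all add: marginal_def)

definition mu :: "(nat \<Rightarrow> bool) measure" where
  "mu = PiM UNIV (\<lambda>n. measure_pmf (marginal n))"

end

theory Submission
  imports Defs
begin

text \<open>Deleting the bit at position \<open>n\<close> multiplies the measure by
  \<open>\<rho> n = m\<^sub>n(0) / m\<^sub>n(1)\<close>, which is \<open>2\<^sup>-\<^sup>k\<close> for \<open>n = nseq k\<close> and \<open>1\<close> off \<open>Nset\<close>. Mass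
  transport therefore forces the weight of \<open>f\<^sup>j x\<close> relative to \<open>x\<close> to be, almost everywhere, the product of
  \<open>\<rho>\<close> over the first \<open>j\<close> ones of \<open>x\<close>. By Borel--Cantelli \<open>x (nseq k)\<close> holds for almost all \<open>k\<close>, so this
  product tends to 0. On the other hand every one of \<open>x\<close> below \<open>nseq (k + 1)\<close> contributes at least
  \<open>2\<^sup>-\<^sup>s\<close> with \<open>s = 0 + \<dots> + k\<close> to the sum, and the ones have positive lower density, so the sum is at
  least of the order of \<open>nseq (k + 1) 2\<^sup>-\<^sup>s \<ge> 2\<^sup>k\<close>.\<close>

section \<open>Resampling one coordinate\<close>

text \<open>The product over \<open>I\<close> is the image of \<open>M i\<close> times the product
  over \<open>I - {i}\<close> under inserting the \<open>i\<close>-th coordinate. Keeping the full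
  product on the right lets later computations stay on one space.\<close>

lemma (in product_prob_space) nn_integral_PiM_resample:
  assumes i: "i \<in> I" and h [measurable]: "h \<in> borel_measurable (PiM I M)"
  shows "(\<integral>\<^sup>+x. h x \<partial>PiM I M) = (\<integral>\<^sup>+x. (\<integral>\<^sup>+a. h (x(i := a)) \<partial>M i) \<partial>PiM I M)"
proof -
  define J where "J = I - {i}"
  have I: "I = insert i J"
    using i by (auto simp: J_def)
  interpret J: prob_space "PiM J M"
    by (intro prob_space_PiM M.prob_space_axioms)
  interpret pair_sigma_finite "M i" "PiM J M" ..
  have upd [measurable]: "(\<lambda>(a, x). x(i := a)) \<in> M i \<Otimes>\<^sub>M PiM J M \<rightarrow>\<^sub>M PiM I M"
    using I by (auto simp: split_beta' intro!: measurable_fun_upd[where J = J])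
  have upd2 [measurable]: "(\<lambda>(x, a). x(i := a)) \<in> PiM I M \<Otimes>\<^sub>M M i \<rightarrow>\<^sub>M PiM I M"
    using I by (auto simp: split_beta' intro!: measurable_fun_upd[where J = I])
  have split: "(\<integral>\<^sup>+x. g x \<partial>PiM I M) = (\<integral>\<^sup>+x. (\<integral>\<^sup>+a. g (x(i := a)) \<partial>M i) \<partial>PiM J M)"
    if g [measurable]: "g \<in> borel_measurable (PiM I M)" for g :: "_ \<Rightarrow> ennreal"
  proof -
    have "(\<integral>\<^sup>+x. g x \<partial>PiM I M) =
        (\<integral>\<^sup>+x. g x \<partial>distr (M i \<Otimes>\<^sub>M PiM J M) (PiM I M) (\<lambda>(a, x). x(i := a)))"
      unfolding I by (subst distr_pair_PiM_eq_PiM) (auto intro: M.prob_space_axioms)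
    also have "\<dots> = (\<integral>\<^sup>+z. g (case z of (a, x) \<Rightarrow> x(i := a)) \<partial>(M i \<Otimes>\<^sub>M PiM J M))"
      by (rule nn_integral_distr) measurable
    also have "\<dots> = (\<integral>\<^sup>+x. (\<integral>\<^sup>+a. g (x(i := a)) \<partial>M i) \<partial>PiM J M)"
      by (subst nn_integral_snd[symmetric]) simp_all
    finally show ?thesis .
  qed
  have "(\<lambda>x. \<integral>\<^sup>+a. h (x(i := a)) \<partial>M i) \<in> borel_measurable (PiM I M)"
    by measurable
  \<comment> \<open>\<open>split\<close> applies to both sides: the inner integral no longer depends on \<open>x i\<close>.\<close>
  from split[OF this] show ?thesis
    by (simp add: split[OF h] M.emeasure_space_1)
qed

interpretation mu: product_prob_space "\<lambda>n. measure_pmf (marginal n)" UNIV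
  rewrites "PiM UNIV (\<lambda>n. measure_pmf (marginal n)) = mu"
  by unfold_locales (simp add: mu_def)

lemma space_mu [simp]: "space mu = UNIV"
  by (simp add: mu_def space_PiM)

lemma measurable_coord_mu [measurable]: "(\<lambda>x. x n) \<in> mu \<rightarrow>\<^sub>M count_space UNIV"
proof -
  have "(\<lambda>x. x n) \<in> mu \<rightarrow>\<^sub>M measure_pmf (marginal n)"
    unfolding mu_def by measurable
  then show ?thesis
    by (simp add: measurable_cong_sets)
qed

lemma measurable_upd_mu [measurable]: "(\<lambda>x. x(n := a)) \<in> mu \<rightarrow>\<^sub>M mu"
  unfolding mu_def by (rule measurable_fun_upd[where J = UNIV]) auto

text \<open>Independence of the coordinates enters the later computations only through this
  two-point formula.\<close>

lemma nn_integral_mu_resample: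
  assumes "h \<in> borel_measurable mu"
  shows "(\<integral>\<^sup>+x. h x \<partial>mu) =
    ennreal (pmf (marginal n) True) * (\<integral>\<^sup>+x. h (x(n := True)) \<partial>mu) +
    ennreal (pmf (marginal n) False) * (\<integral>\<^sup>+x. h (x(n := False)) \<partial>mu)"
proof -
  note [measurable] = assms
  have "(\<integral>\<^sup>+a. h (x(n := a)) \<partial>measure_pmf (marginal n)) =
    ennreal (pmf (marginal n) True) * h (x(n := True)) +
    ennreal (pmf (marginal n) False) * h (x(n := False))" for x
    by (subst nn_integral_measure_pmf_support[of UNIV]) (auto simp: UNIV_bool mult.commute add.commute)
  then show ?thesis
    using mu.nn_integral_PiM_resample[of n h] assms
    by (simp add: nn_integral_add nn_integral_cmult)
qed

section \<open>Weights of single deletions\<close>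

definition deletion_weight :: "nat \<Rightarrow> real" where
  "deletion_weight n = pmf (marginal n) False / pmf (marginal n) True"

lemma deletion_weight_nseq: "1 \<le> k \<Longrightarrow> deletion_weight (nseq k) = 1 / 2 ^ k"
  by (simp add: deletion_weight_def marginal_nseq)
    (metis add_pos_pos less_irrefl zero_less_numeral zero_less_one zero_less_power)

lemma deletion_weight_notin: "n \<notin> Nset \<Longrightarrow> deletion_weight n = 1"
  by (simp add: deletion_weight_def marginal_notin)

text \<open>Positive mass at \<open>False\<close> makes clearing a bit nonsingular; the bound
  \<open>1 / 2\<close> at \<open>True\<close> gives the ones positive lower density.\<close>

lemma marginal_bounds:
  shows "0 < pmf (marginal n) False" and "1 / 2 \<le> pmf (marginal n) True"
proof -
  have "0 < pmf (marginal n) False \<and> 1 / 2 \<le> pmf (marginal n) True"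
  proof (cases "n \<in> Nset")
    case True
    then obtain k where "n = nseq k" "1 \<le> k" by (auto simp: Nset_def)
    moreover have "0 < (2 ^ k + 1 :: real)" by (simp add: add_pos_pos)
    ultimately show ?thesis by (simp add: marginal_nseq field_simps)
  qed (simp add: marginal_notin)
  then show "0 < pmf (marginal n) False" "1 / 2 \<le> pmf (marginal n) True" by auto
qed

lemma deletion_weight_pos: "0 < deletion_weight n"
  using marginal_bounds[of n] by (simp add: deletion_weight_def)

lemma deletion_weight_le_1: "deletion_weight n \<le> 1"
proof (cases "n \<in> Nset")
  case True
  then show ?thesis by (auto simp: Nset_def deletion_weight_nseq)
qed (simp add: deletion_weight_notin)

text \<open>Below \<open>nseq (Suc k)\<close> only \<open>nseq 1\<close>, ..., \<open>nseq k\<close>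
  have a weight other than 1, and \<open>nseq i\<close> contributes 2^-i.\<close>

lemma prod_deletion_weight_below_nseq:
  "(\<Prod>n<nseq (Suc k). deletion_weight n) = 1 / 2 ^ (\<Sum>i\<le>k. i)"
proof -
  have "{..<nseq (Suc k)} \<inter> Nset = nseq ` {1..k}"
    using strict_mono_less[OF strict_mono_nseq] by (fastforce simp: Nset_def simp del: nseq.simps)
  then have "(\<Prod>n<nseq (Suc k). deletion_weight n) = (\<Prod>n\<in>nseq ` {1..k}. deletion_weight n)"
    by (intro prod.mono_neutral_right) (blast intro: deletion_weight_notin | simp)+
  also have "\<dots> = (\<Prod>i\<in>{1..k}. 1 / 2 ^ i)"
    by (subst prod.reindex)
      (auto intro!: prod.cong inj_onI simp: strict_mono_eq[OF strict_mono_nseq] deletion_weight_nseq)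
  also have "\<dots> = 1 / 2 ^ (\<Sum>i\<in>{1..k}. i)"
    by (simp add: prod_dividef power_sum)
  also have "(\<Sum>i\<in>{1..k}. i) = (\<Sum>i\<le>k. i)"
    by (intro sum.mono_neutral_left) auto
  finally show ?thesis .
qed

section \<open>Nonsingularity and change of measure under clearing a bit\<close>

text \<open>Resampling bounds the measure of a null set below by m_n(0) > 0 times the measure of its
  preimage under clearing bit \<open>n\<close>.\<close>

lemma AE_mu_clear_bit:
  assumes "AE x in mu. P x"
  shows "AE x in mu. P (x(n := False))"
proof -
  obtain Z where Z: "{x. \<not> P x} \<subseteq> Z" "Z \<in> sets mu" "emeasure mu Z = 0"
    using AE_E[OF assms] by (auto simp: space_mu)
  note [measurable] = Z(2)
  have "0 = (\<integral>\<^sup>+x. indicator Z x \<partial>mu)"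
    using Z by simp
  also have "\<dots> = ennreal (pmf (marginal n) True) * (\<integral>\<^sup>+x. indicator Z (x(n := True)) \<partial>mu) +
      ennreal (pmf (marginal n) False) * (\<integral>\<^sup>+x. indicator Z (x(n := False)) \<partial>mu)"
    by (rule nn_integral_mu_resample) simp
  finally have "(\<integral>\<^sup>+x. indicator Z (x(n := False)) \<partial>mu) = 0"
    using marginal_bounds(1)[of n] by (simp add: eq_commute[of 0])
  then have "AE x in mu. indicator Z (x(n := False)) = (0 :: ennreal)"
    by (subst (asm) nn_integral_0_iff_AE) (simp_all, measurable)
  then show ?thesis
    by eventually_elim (use Z(1) in \<open>auto simp: indicator_def split: if_splits\<close>)
qed

text \<open>The weight of one deletion is determined only almost everywhere, yet it is needed at
  every point of a forward orbit. Least deletion clears one of countably many bits, so preimages of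
  null sets under its iterates stay null.\<close>

lemma AE_mu_least_deletion_funpow:
  assumes "AE x in mu. P x"
  shows "AE x in mu. \<forall>k. P ((least_deletion ^^ k) x)"
proof -
  have step: "AE x in mu. Q (least_deletion x)" if "AE x in mu. Q x" for Q
  proof -
    \<comment> \<open>At every \<open>x\<close>, even the zero sequence, where \<open>LEAST\<close>
      is unspecified, \<open>least_deletion\<close> clears some bit \<open>n\<close>.\<close>
    have "AE x in mu. \<forall>n. Q (x(n := False))"
      using AE_mu_clear_bit[OF that] by (simp add: AE_all_countable)
    then show ?thesis
      by eventually_elim (simp add: least_deletion_def)
  qed
  have "AE x in mu. P ((least_deletion ^^ k) x)" for k
  proof (induction k)
    case (Suc k)
    from step[OF this] show ?case by (simp add: funpow_swap1)
  qed (use assms in simp)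
  then show ?thesis by (simp add: AE_all_countable)
qed

text \<open>The set on the left is the image of \<open>C\<close> under clearing bit
  \<open>n\<close>, written as a preimage to make it measurable. Resampling turns both measures into
  multiples of the same integral \<open>G\<close>, with factors m_n(0) and m_n(1).\<close>

lemma measure_mu_clear_bit:
  assumes [measurable]: "C \<in> sets mu" and C: "\<And>x. x \<in> C \<Longrightarrow> x n"
  shows "measure mu {x. \<not> x n \<and> x(n := True) \<in> C} = deletion_weight n * measure mu C"
proof -
  define G where "G = (\<integral>\<^sup>+x. indicator C (x(n := True)) \<partial>mu)"
  let ?D = "{x. \<not> x n \<and> x(n := True) \<in> C}"
  have D: "?D \<in> sets mu"
  proof -
    have "{x \<in> space mu. \<not> x n \<and> x(n := True) \<in> C} \<in> sets mu" by measurable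
    then show ?thesis by simp
  qed
  note [measurable] = D
  have "emeasure mu C = (\<integral>\<^sup>+x. indicator C x \<partial>mu)" by simp
  also have "\<dots> = ennreal (pmf (marginal n) True) * (\<integral>\<^sup>+x. indicator C (x(n := True)) \<partial>mu) +
      ennreal (pmf (marginal n) False) * (\<integral>\<^sup>+x. indicator C (x(n := False)) \<partial>mu)"
    by (rule nn_integral_mu_resample) simp
  also have "\<dots> = ennreal (pmf (marginal n) True) * G"
  proof -
    have "indicator C (x(n := False)) = (0 :: ennreal)" for x
      using C[of "x(n := False)"] by (auto simp: indicator_def)
    then show ?thesis by (simp add: G_def)
  qed
  finally have mC: "emeasure mu C = ennreal (pmf (marginal n) True) * G" .
  have "emeasure mu ?D = (\<integral>\<^sup>+x. indicator ?D x \<partial>mu)" using D by simp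
  also have "\<dots> = ennreal (pmf (marginal n) True) * (\<integral>\<^sup>+x. indicator ?D (x(n := True)) \<partial>mu) +
      ennreal (pmf (marginal n) False) * (\<integral>\<^sup>+x. indicator ?D (x(n := False)) \<partial>mu)"
    by (rule nn_integral_mu_resample) simp
  also have "\<dots> = ennreal (pmf (marginal n) False) * G"
    by (simp add: G_def indicator_def)
  finally have mD: "emeasure mu ?D = ennreal (pmf (marginal n) False) * G" .
  \<comment> \<open>Cross-multiplying eliminates \<open>G\<close> without a division in
    \<open>ennreal\<close>.\<close>
  have "emeasure mu ?D * ennreal (pmf (marginal n) True) =
      emeasure mu C * ennreal (pmf (marginal n) False)"
    by (simp add: mC mD ac_simps)
  then have "measure mu ?D * pmf (marginal n) True = measure mu C * pmf (marginal n) False"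
    by (simp add: mu.emeasure_eq_measure flip: ennreal_mult'')
  then show ?thesis
    using marginal_bounds[of n] by (simp add: deletion_weight_def field_simps)
qed

section \<open>The cocycle at one deletion, from mass transport\<close>

lemma sets_inf_ones [measurable]: "inf_ones \<in> sets mu"
proof -
  have "inf_ones = {x \<in> space mu. \<forall>m. \<exists>n>m. x n}"
    by (auto simp: inf_ones_def infinite_nat_iff_unbounded)
  also have "\<dots> \<in> sets mu" by measurable
  finally show ?thesis .
qed

lemma Least_eq_first_one: "x n \<Longrightarrow> (\<And>i. i < n \<Longrightarrow> \<not> x i) \<Longrightarrow> (LEAST i. x i) = (n :: nat)"
  by (rule Least_equality) (auto intro: leI)

text \<open>Where the first one sits at \<open>n\<close>, the map is the injection
  \<open>\<gamma>\<close> clearing bit \<open>n\<close>. Mass transport of indicators of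
  \<open>\<gamma>\<close>-images shows that the weight and the constant
  \<open>deletion_weight n\<close> have equal integrals over all measurable subsets, so they agree
  almost everywhere. Countably many \<open>n\<close> cover \<open>inf_ones\<close>.\<close>

lemma cocycle_least_deletion:
  assumes "radon_nikodym_cocycle (restrict_space mu inf_ones)
             (orbit_equiv inf_ones least_deletion) w"
  shows "AE x in mu. x \<in> inf_ones \<longrightarrow> w x (least_deletion x) = deletion_weight (LEAST n. x n)"
proof -
  define M where "M = restrict_space mu inf_ones"
  interpret M: finite_measure M
    unfolding M_def by (rule finite_measure_restrict_space) (use mu.finite_measure_axioms in auto)
  have sets_M: "S \<in> sets M \<longleftrightarrow> S \<in> sets mu \<and> S \<subseteq> inf_ones" for S
    unfolding M_def by (subst sets_restrict_space_iff) auto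
  have measure_M: "measure M S = measure mu S" if "S \<in> sets M" for S
    using that unfolding M_def by (subst measure_restrict_space) (auto simp: sets_M[unfolded M_def])
  have "AE x in mu. x \<in> inf_ones \<longrightarrow> x n \<longrightarrow> (\<forall>i<n. \<not> x i) \<longrightarrow>
    w x (x(n := False)) = deletion_weight n" for n
  proof -
    define A where "A = {x \<in> inf_ones. x n \<and> (\<forall>i<n. \<not> x i)}"
    define B where "B = {x \<in> inf_ones. \<forall>i\<le>n. \<not> x i}"
    define \<gamma> :: "(nat \<Rightarrow> bool) \<Rightarrow> nat \<Rightarrow> bool" where "\<gamma> x = x(n := False)" for x
    have upd: "x(n := b) \<in> inf_ones \<longleftrightarrow> x \<in> inf_ones" for x b
    proof -
      have "{i. (x(n := b)) i} - {n} = {i. x i} - {n}" by auto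
      then show ?thesis unfolding inf_ones_def mem_Collect_eq
        by (metis finite_insert infinite_remove insert_Diff_single)
    qed
    have A: "A \<in> sets M"
    proof -
      have "{x \<in> space mu. x \<in> inf_ones \<and> x n \<and> (\<forall>i<n. \<not> x i)} \<in> sets mu" by measurable
      then show ?thesis by (auto simp: sets_M A_def)
    qed
    have B: "B \<in> sets M"
    proof -
      have "{x \<in> space mu. x \<in> inf_ones \<and> (\<forall>i\<le>n. \<not> x i)} \<in> sets mu" by measurable
      then show ?thesis by (auto simp: sets_M B_def)
    qed
    note [measurable] = A B
    have \<gamma>_meas: "\<gamma> \<in> restrict_space M A \<rightarrow>\<^sub>M M"
    proof -
      have "\<gamma> \<in> M \<rightarrow>\<^sub>M M"
        unfolding M_def \<gamma>_def
        by (intro measurable_restrict_space3) (auto simp: upd)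
      then show ?thesis by (rule measurable_restrict_space1)
    qed
    have bij: "bij_betw \<gamma> A B"
      by (rule bij_betwI[where g = "\<lambda>x. x(n := True)"])
        (auto simp: A_def B_def \<gamma>_def upd fun_upd_idem)
    have E: "\<forall>x\<in>A. (\<gamma> x, x) \<in> orbit_equiv inf_ones least_deletion"
    proof
      fix x assume x: "x \<in> A"
      then have "(LEAST i. x i) = n"
        by (intro Least_eq_first_one) (auto simp: A_def)
      then have "\<gamma> x = least_deletion x"
        by (simp add: \<gamma>_def least_deletion_def)
      then have "(least_deletion ^^ 0) (\<gamma> x) = (least_deletion ^^ 1) x" by simp
      then show "(\<gamma> x, x) \<in> orbit_equiv inf_ones least_deletion"
        using x upd unfolding orbit_equiv_def A_def \<gamma>_def by blast
    qed
    have transport: "set_integrable M A (\<lambda>x. \<phi> (\<gamma> x) * w x (\<gamma> x))"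
        "(LINT x:B|M. \<phi> x) = (LINT x:A|M. \<phi> (\<gamma> x) * w x (\<gamma> x))"
      if "integrable M \<phi>" for \<phi> :: "_ \<Rightarrow> real"
      using assms A B \<gamma>_meas bij E that
      unfolding radon_nikodym_cocycle_def tilted_mass_transport_def M_def[symmetric] by blast+
    \<comment> \<open>The factor \<open>indicator A\<close> confines both densities to the domain of
      \<open>\<gamma>\<close>, so that they can be compared on every measurable \<open>C\<close>.
      The first is integrable by transport of the constant 1.\<close>
    have "AE x in M. indicator A x * w x (\<gamma> x) = indicator A x * deletion_weight n"
    proof (rule density_unique_real)
      show "integrable M (\<lambda>x. indicator A x * w x (\<gamma> x))"
        using transport(1)[of "\<lambda>_. 1"] by (simp add: set_integrable_def)
      show "integrable M (\<lambda>x. indicator A x * deletion_weight n)"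
        by (intro integrable_mult_left integrable_real_indicator) (auto simp: A M.emeasure_eq_measure)
      fix C assume C: "C \<in> sets M"
      \<comment> \<open>\<open>D\<close> is the image of \<open>C \<inter> A\<close> under
        \<open>\<gamma>\<close>: for \<open>x\<close> in \<open>A\<close>, \<open>\<gamma> x\<close>
        lies in \<open>D\<close> exactly when \<open>x\<close> lies in \<open>C\<close>. The test
        function is \<open>indicator D\<close>.\<close>
      define D where "D = {x. \<not> x n \<and> x(n := True) \<in> C \<inter> A}"
      have CA: "C \<inter> A \<in> sets mu"
        using A C by (auto simp: sets_M)
      have D: "D \<in> sets M"
      proof -
        have "{x \<in> space mu. \<not> x n \<and> x(n := True) \<in> C \<inter> A} \<in> sets mu"
          using CA by measurable
        then show ?thesis by (auto simp: sets_M D_def A_def upd)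
      qed
      have DB: "D \<subseteq> B"
        by (auto simp: D_def A_def B_def upd le_less)
      have "deletion_weight n * measure M (C \<inter> A) = measure M D"
      proof -
        have "measure mu D = deletion_weight n * measure mu (C \<inter> A)"
          unfolding D_def by (rule measure_mu_clear_bit[OF CA]) (simp add: A_def)
        then show ?thesis
          by (simp only: measure_M[OF D] measure_M[OF sets.Int[OF C A]])
      qed
      also have "\<dots> = (LINT x:B|M. indicator D x)"
      proof -
        have "B \<inter> D = D" using DB by auto
        then show ?thesis using D
          by (simp add: set_lebesgue_integral_def indicator_inter_arith[symmetric])
      qed
      also have "\<dots> = (LINT x:A|M. indicator D (\<gamma> x) * w x (\<gamma> x))"
        by (intro transport(2) integrable_real_indicator) (auto simp: D M.emeasure_eq_measure)
      also have "\<dots> = (LINT x:C|M. indicator A x * w x (\<gamma> x))"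
        unfolding set_lebesgue_integral_def
        by (intro Bochner_Integration.integral_cong)
          (auto simp: indicator_def D_def \<gamma>_def A_def fun_upd_idem)
      finally have "(LINT x:C|M. indicator A x * w x (\<gamma> x)) = deletion_weight n * measure M (C \<inter> A)" ..
      also have "\<dots> = (LINT x:C|M. indicator A x * deletion_weight n)"
      proof -
        have *: "(\<lambda>x. indicator C x *\<^sub>R (indicator A x * deletion_weight n)) =
            (\<lambda>x. deletion_weight n * indicator (C \<inter> A) x)"
          by (auto simp: indicator_def)
        show ?thesis
          using sets.Int[OF C A] unfolding set_lebesgue_integral_def * by simp
      qed
      finally show "(LINT x:C|M. indicator A x * w x (\<gamma> x)) =
          (LINT x:C|M. indicator A x * deletion_weight n)" .
    qed
    then have "AE x in mu. x \<in> inf_ones \<longrightarrow>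
        indicator A x * w x (\<gamma> x) = indicator A x * deletion_weight n"
      unfolding M_def by (subst (asm) AE_restrict_space_iff) auto
    then show ?thesis
      by eventually_elim (auto simp: A_def \<gamma>_def)
  qed
  then have "AE x in mu. \<forall>n. x \<in> inf_ones \<longrightarrow> x n \<longrightarrow> (\<forall>i<n. \<not> x i) \<longrightarrow>
      w x (x(n := False)) = deletion_weight n"
    by (subst AE_all_countable) blast
  then show ?thesis
  proof eventually_elim
    case (elim x)
    show ?case
    proof
      assume x: "x \<in> inf_ones"
      then obtain m where "x m"
        by (auto simp: inf_ones_def dest!: infinite_imp_nonempty)
      then have "x (LEAST n. x n)"
        by (rule LeastI)
      moreover have "\<forall>i<LEAST n. x n. \<not> x i"
        using not_less_Least by blast
      ultimately show "w x (least_deletion x) = deletion_weight (LEAST n. x n)"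
        unfolding least_deletion_def using elim x by blast
    qed
  qed
qed

section \<open>Weights along the forward geodesic\<close>

declare nseq.simps(2) [simp del]

text \<open>Least deletion removes the minimum of the set of ones, which is the recursion of
  \<open>enumerate\<close>; both indices start at 0.\<close>

lemma Least_funpow_least_deletion:
  "(LEAST n. (least_deletion ^^ i) x n) = enumerate {n. x n} i"
proof (induction i arbitrary: x)
  case (Suc i)
  have "{n. least_deletion x n} = {n. x n} - {LEAST n. n \<in> {n. x n}}"
    by (auto simp: least_deletion_def)
  then show ?case
    using Suc[of "least_deletion x"] by (simp add: funpow_swap1 enumerate_Suc)
qed (simp add: enumerate_0)

lemma funpow_least_deletion_in_inf_ones:
  "x \<in> inf_ones \<Longrightarrow> (least_deletion ^^ k) x \<in> inf_ones"
  by (induction k) (auto intro: least_deletion_in_inf_ones)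

lemma orbit_equiv_funpow:
  assumes "(f ^^ i) x \<in> X" "(f ^^ j) x \<in> X"
  shows "((f ^^ i) x, (f ^^ j) x) \<in> orbit_equiv X f"
proof -
  have "(f ^^ j) ((f ^^ i) x) = (f ^^ i) ((f ^^ j) x)"
    by (metis add.commute comp_apply funpow_add)
  with assms show ?thesis unfolding orbit_equiv_def by blast
qed

text \<open>The cocycle identity telescopes along the orbit, and the \<open>i\<close>-th deletion
  removes the \<open>i\<close>-th one of \<open>x\<close>.\<close>

lemma cocycle_forward_geodesic:
  assumes w: "radon_nikodym_cocycle (restrict_space mu inf_ones)
             (orbit_equiv inf_ones least_deletion) w"
  shows "AE x in mu. x \<in> inf_ones \<longrightarrow>
    (\<forall>k. w x ((least_deletion ^^ k) x) = (\<Prod>i<k. deletion_weight (enumerate {n. x n} i)))"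
  using AE_mu_least_deletion_funpow[OF cocycle_least_deletion[OF w]]
proof eventually_elim
  case (elim x)
  show ?case
  proof (intro impI allI)
    fix k assume x: "x \<in> inf_ones"
    note orb = funpow_least_deletion_in_inf_ones[OF x]
    note rel = orbit_equiv_funpow[OF orb orb]
    have pos: "w y z > 0" and mult: "w y u = w y z * w z u"
      if "(y, z) \<in> orbit_equiv inf_ones least_deletion"
        "(z, u) \<in> orbit_equiv inf_ones least_deletion" for y z u
      using w that unfolding radon_nikodym_cocycle_def by blast+
    show "w x ((least_deletion ^^ k) x) = (\<Prod>i<k. deletion_weight (enumerate {n. x n} i))"
    proof (induction k)
      case 0
      \<comment> \<open>From \<open>w x x = w x x * w x x\<close> and positivity,
        \<open>w x x = 1\<close>.\<close>
      show ?case using pos[OF rel[of 0 0] rel[of 0 0]] mult[OF rel[of 0 0] rel[of 0 0]] by simp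
    next
      case (Suc k)
      show ?case
        using mult[OF rel[of 0 k] rel[of k "Suc k"]] elim orb[of k] Suc
        by (simp add: Least_funpow_least_deletion)
    qed
  qed
qed

section \<open>Products of weights along an enumerated set of positions\<close>

text \<open>If element number \<open>j\<close> were at least \<open>m\<close>, all elements below
  \<open>m\<close> would be among the first \<open>j\<close>.\<close>

lemma enumerate_less_if_card:
  fixes S :: "nat set"
  assumes S: "infinite S" and j: "j < card {n \<in> S. n < m}"
  shows "enumerate S j < m"
proof (rule ccontr)
  assume *: "\<not> enumerate S j < m"
  have "{n \<in> S. n < m} \<subseteq> enumerate S ` {..<j}"
  proof
    fix n assume n: "n \<in> {n \<in> S. n < m}"
    then obtain i where i: "n = enumerate S i"
      using range_enumerate[OF S] by auto
    with n * have "enumerate S i < enumerate S j" by simp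
    with S i show "n \<in> enumerate S ` {..<j}" by simp
  qed
  then have "card {n \<in> S. n < m} \<le> card {..<j}"
    by (meson surj_card_le finite_lessThan)
  with j show False by simp
qed

text \<open>All factors lie in (0, 1], so a single factor bounds every product containing it, and
  \<open>S\<close> contains \<open>nseq k\<close>, of weight 2^-k, for arbitrarily large
  \<open>k\<close>.\<close>

lemma prod_deletion_weight_tendsto_0:
  assumes S: "infinite S" and N: "eventually (\<lambda>k. nseq k \<in> S) sequentially"
  shows "(\<lambda>k. \<Prod>i<k. deletion_weight (enumerate S i)) \<longlonglongrightarrow> 0"
proof (rule LIMSEQ_I)
  let ?r = "\<lambda>i. deletion_weight (enumerate S i)"
  fix e :: real assume "0 < e"
  then have "eventually (\<lambda>k. (1 / 2) ^ k < e) sequentially"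
    using order_tendstoD(2)[OF LIMSEQ_realpow_zero[of "1 / 2 :: real"]] by simp
  with N have "eventually (\<lambda>k. nseq k \<in> S \<and> (1 / 2) ^ k < e \<and> 1 \<le> k) sequentially"
    using eventually_ge_at_top[of 1] by eventually_elim simp
  then obtain k where k: "nseq k \<in> S" "(1 / 2) ^ k < e" "1 \<le> k"
    by (auto dest: eventually_happens)
  then obtain j where j: "nseq k = enumerate S j"
    using range_enumerate[OF S] by auto
  have "norm ((\<Prod>i<l. ?r i) - 0) < e" if "Suc j \<le> l" for l
  proof -
    have "(\<Prod>i<l. ?r i) = ?r j * (\<Prod>i\<in>{..<l} - {j}. ?r i)"
      using that by (intro prod.remove) auto
    also have "\<dots> \<le> ?r j * 1"
      using deletion_weight_pos deletion_weight_le_1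
      by (intro mult_left_mono prod_le_1) (auto intro: less_imp_le)
    also have "?r j = (1 / 2) ^ k"
      using k j deletion_weight_nseq[of k] by (simp add: power_divide)
    finally show ?thesis
      using k(2) prod_pos[of "{..<l}" ?r] deletion_weight_pos by simp
  qed
  then show "\<exists>l0. \<forall>l\<ge>l0. norm ((\<Prod>i<l. ?r i) - 0) < e" by blast
qed

text \<open>For \<open>j < c\<close> the first \<open>j\<close> elements of \<open>S\<close> lie
  below \<open>nseq (Suc k)\<close>. As no weight exceeds 1, their product is at least the product
  over all positions below \<open>nseq (Suc k)\<close>.\<close>

lemma sum_prod_deletion_weight_ge:
  assumes S: "infinite S" and c: "c = card {n \<in> S. n < nseq (Suc k)}"
  shows "real c / 2 ^ (\<Sum>i\<le>k. i) \<le> (\<Sum>j<c. \<Prod>i<j. deletion_weight (enumerate S i))"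
proof -
  have "1 / 2 ^ (\<Sum>i\<le>k. i) \<le> (\<Prod>i<j. deletion_weight (enumerate S i))" if "j < c" for j
  proof -
    have "1 / 2 ^ (\<Sum>i\<le>k. i) = (\<Prod>n<nseq (Suc k). deletion_weight n)"
      by (rule prod_deletion_weight_below_nseq[symmetric])
    also have "\<dots> = (\<Prod>n\<in>{..<nseq (Suc k)} - enumerate S ` {..<j}. deletion_weight n) *
        (\<Prod>n\<in>enumerate S ` {..<j}. deletion_weight n)"
      using that unfolding c
      by (intro prod.subset_diff) (auto intro!: enumerate_less_if_card[OF S])
    also have "\<dots> \<le> 1 * (\<Prod>n\<in>enumerate S ` {..<j}. deletion_weight n)"
      using deletion_weight_pos deletion_weight_le_1
      by (intro mult_right_mono prod_le_1 prod_nonneg) (auto intro: less_imp_le)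
    also have "1 * (\<Prod>n\<in>enumerate S ` {..<j}. deletion_weight n) =
        (\<Prod>n\<in>enumerate S ` {..<j}. deletion_weight n)" by simp
    also have "\<dots> = (\<Prod>i<j. deletion_weight (enumerate S i))"
      using S by (subst prod.reindex) (auto intro: inj_on_subset[OF inj_enumerate])
    finally show ?thesis .
  qed
  then have "(\<Sum>j<c. 1 / 2 ^ (\<Sum>i\<le>k. i)) \<le> (\<Sum>j<c. \<Prod>i<j. deletion_weight (enumerate S i))"
    by (intro sum_mono) auto
  then show ?thesis by simp
qed

text \<open>With s the sum up to \<open>k\<close>, the last increment 2^(k s) suffices: k + s \<le>
  2 s \<le> k s, by s \<ge> k and k \<ge> 2. This is where the gaps of \<open>nseq\<close> beat the
  decay 2^-s of the weights.\<close>

lemma nseq_Suc_ge: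
  assumes "2 \<le> k"
  shows "2 ^ k * 2 ^ (\<Sum>i\<le>k. i) \<le> nseq (Suc k)"
proof -
  have "k \<le> (\<Sum>i\<le>k. i)"
    by (rule member_le_sum) auto
  then have "k + (\<Sum>i\<le>k. i) \<le> 2 * (\<Sum>i\<le>k. i)" by simp
  also have "\<dots> \<le> k * (\<Sum>i\<le>k. i)" using assms by (rule mult_right_mono) simp
  finally have "(2::nat) ^ (k + (\<Sum>i\<le>k. i)) \<le> 2 ^ (k * (\<Sum>i\<le>k. i))"
    by (rule power_increasing) simp
  then show ?thesis by (simp add: power_add nseq.simps(2))
qed

text \<open>Only the cutoffs \<open>m = nseq (Suc k)\<close> of the density bound are used; each
  bounds the sum below by \<open>2 ^ k / 8\<close>.\<close>

lemma suminf_prod_deletion_weight: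
  assumes S: "infinite S"
    and density: "eventually (\<lambda>m. m / 8 \<le> card {n \<in> S. n < m}) sequentially"
  shows "(\<Sum>j. ennreal (\<Prod>i<j. deletion_weight (enumerate S i))) = \<infinity>"
proof -
  let ?W = "\<lambda>j. \<Prod>i<j. deletion_weight (enumerate S i)"
  have W: "0 \<le> ?W j" for j
    by (intro prod_nonneg ballI less_imp_le[OF deletion_weight_pos])
  have "filterlim (\<lambda>k. nseq (Suc k)) at_top sequentially"
    using strict_mono_nseq by (intro filterlim_compose[OF filterlim_subseq filterlim_Suc])
  with density have "eventually (\<lambda>k. nseq (Suc k) / 8 \<le> card {n \<in> S. n < nseq (Suc k)}) sequentially"
    unfolding filterlim_iff by blast
  then have bound: "eventually (\<lambda>k. ennreal (2 ^ k / 8) \<le> (\<Sum>j. ennreal (?W j))) sequentially"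
    using eventually_ge_at_top[of 2]
  proof eventually_elim
    case (elim k)
    define c where "c = card {n \<in> S. n < nseq (Suc k)}"
    have "2 ^ k * 2 ^ (\<Sum>i\<le>k. i) \<le> real (nseq (Suc k))"
      using of_nat_mono[OF nseq_Suc_ge[OF elim(2)], where ?'a = real] by simp
    also have "\<dots> \<le> 8 * c" using elim(1) by (simp add: c_def)
    finally have "2 ^ k / 8 \<le> c / 2 ^ (\<Sum>i\<le>k. i)" by (simp add: field_simps)
    also have "\<dots> \<le> (\<Sum>j<c. ?W j)"
      by (rule sum_prod_deletion_weight_ge[OF S c_def])
    finally have "ennreal (2 ^ k / 8) \<le> (\<Sum>j<c. ennreal (?W j))"
      using W by (subst sum_ennreal) (auto intro: ennreal_leI)
    also have "\<dots> \<le> (\<Sum>j. ennreal (?W j))" by (rule sum_le_suminf) auto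
    finally show ?case .
  qed
  have "(\<lambda>k. ennreal (2 ^ k / 8)) \<longlonglongrightarrow> \<infinity>"
  proof -
    have "filterlim (\<lambda>k. 2 ^ k :: real) at_top sequentially"
      by (rule filterlim_at_top_mono[OF filterlim_real_sequentially])
        (auto intro: less_imp_le[OF of_nat_less_two_power])
    then have "filterlim (\<lambda>k. 1 / 8 * 2 ^ k :: real) at_top sequentially"
      by (intro filterlim_tendsto_pos_mult_at_top[OF tendsto_const]) auto
    then show ?thesis by (simp add: ennreal_tendsto_top_eq_at_top)
  qed
  from tendsto_upperbound[OF this bound] show ?thesis by (simp add: top_unique)
qed

section \<open>Ones of a random sequence\<close>

text \<open>First Borel-Cantelli lemma: the probabilities of a zero at the positions
  \<open>nseq k\<close> are summable.\<close>

lemma AE_mu_nseq_eventually: "AE x in mu. eventually (\<lambda>k. x (nseq k)) sequentially"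
proof -
  have meas: "{x. \<not> x n} \<in> sets mu" for n
  proof -
    have "{x \<in> space mu. \<not> x n} \<in> sets mu" by measurable
    then show ?thesis by simp
  qed
  have prob: "measure mu {x. \<not> x n} = pmf (marginal n) False" for n
  proof -
    note [measurable] = meas
    have "emeasure mu {x. \<not> x n} = (\<integral>\<^sup>+x. indicator {x. \<not> x n} x \<partial>mu)" using meas by simp
    also have "\<dots> = ennreal (pmf (marginal n) True) * (\<integral>\<^sup>+x. indicator {x. \<not> x n} (x(n := True)) \<partial>mu)
        + ennreal (pmf (marginal n) False) * (\<integral>\<^sup>+x. indicator {x. \<not> x n} (x(n := False)) \<partial>mu)"
      by (rule nn_integral_mu_resample) simp
    also have "\<dots> = ennreal (pmf (marginal n) False)"
      using mu.P.emeasure_space_1 by simp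
    finally show ?thesis by (simp add: measure_def)
  qed
  \<comment> \<open>The shift to \<open>Suc k\<close> skips \<open>nseq 0\<close>, which is outside
    \<open>Nset\<close> and has a fair bit.\<close>
  have "AE x in mu. eventually (\<lambda>k. x \<in> space mu - {x. \<not> x (nseq (Suc k))}) sequentially"
  proof (rule borel_cantelli_AE1)
    have "measure mu {x. \<not> x (nseq (Suc k))} \<le> (1 / 2) ^ k" for k
    proof -
      have "1 / (2 ^ Suc k + 1) \<le> 1 / (2 ^ k :: real)"
        by (rule divide_left_mono) (auto simp: add_pos_pos)
      then show ?thesis
        unfolding prob using marginal_nseq(1)[of "Suc k"] by (simp add: power_divide)
    qed
    then show "summable (\<lambda>k. measure mu {x. \<not> x (nseq (Suc k))})"
      by (intro summable_comparison_test'[OF summable_geometric[of "1 / 2 :: real"], of 0]) auto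
  qed (auto simp: meas mu.emeasure_eq_measure)
  then show ?thesis
    by eventually_elim (simp add: eventually_sequentially_Suc[where P = "\<lambda>k. _ (nseq k)"])
qed

section \<open>Lower density of the ones\<close>

text \<open>The sum form makes both measurability and the effect of changing one bit
  evident.\<close>

lemma card_ones_below: "card {n. x n \<and> n < m} = (\<Sum>n<m. if x n then 1 else 0)" for m :: nat
  by (simp add: sum.If_cases Int_def conj_commute)

lemma measurable_card_ones_below:
  "(\<lambda>x. card {n. x n \<and> n < m}) \<in> mu \<rightarrow>\<^sub>M count_space UNIV"
  unfolding card_ones_below by measurable

text \<open>An exponential moment of the count of ones: resampling bit \<open>m\<close> contributes
  the factor p / 2 + (1 - p) = 1 - p / 2, at most 3 / 4 because p \<ge> 1 / 2.\<close>

lemma nn_integral_half_power_ones_le: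
  "(\<integral>\<^sup>+x. ennreal ((1 / 2) ^ card {n. x n \<and> n < m}) \<partial>mu) \<le> ennreal ((3 / 4) ^ m)"
proof (induction m)
  case 0
  show ?case using mu.P.emeasure_space_1 by simp
next
  case (Suc m)
  define c where "c m x = card {n. x n \<and> n < m}" for m and x :: "nat \<Rightarrow> bool"
  have c_sum: "c m x = (\<Sum>n<m. if x n then 1 else 0)" for m x
    by (simp add: c_def card_ones_below)
  have [measurable]: "c m \<in> mu \<rightarrow>\<^sub>M count_space UNIV" for m
    unfolding c_def by (rule measurable_card_ones_below)
  define G where "G = (\<integral>\<^sup>+x. ennreal ((1 / 2) ^ c m x) \<partial>mu)"
  define p where "p = pmf (marginal m) True"
  have p: "1 / 2 \<le> p" "p \<le> 1" "pmf (marginal m) False = 1 - p"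
    using marginal_bounds[of m] by (auto simp: p_def pmf_le_1 pmf_False_conv_True)
  have upd: "c m (x(m := b)) = c m x" for x b
    by (auto simp: c_sum intro!: sum.cong)
  have "(\<integral>\<^sup>+x. ennreal ((1 / 2) ^ c (Suc m) x) \<partial>mu) =
      ennreal p * (\<integral>\<^sup>+x. ennreal ((1 / 2) ^ c (Suc m) (x(m := True))) \<partial>mu)
      + ennreal (1 - p) * (\<integral>\<^sup>+x. ennreal ((1 / 2) ^ c (Suc m) (x(m := False))) \<partial>mu)"
    unfolding p_def p(3)[symmetric, unfolded p_def] by (rule nn_integral_mu_resample) measurable
  also have "(\<integral>\<^sup>+x. ennreal ((1 / 2) ^ c (Suc m) (x(m := True))) \<partial>mu) = ennreal (1 / 2) * G"
  proof -
    have "c (Suc m) (x(m := True)) = Suc (c m x)" for x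
      using upd[of x True] by (simp add: c_sum)
    then have "ennreal ((1 / 2) ^ c (Suc m) (x(m := True))) = ennreal (1 / 2) * ennreal ((1 / 2) ^ c m x)" for x
      by (simp only: power_Suc) (rule ennreal_mult', simp)
    then show ?thesis
      unfolding G_def by (simp only:) (rule nn_integral_cmult, measurable)
  qed
  also have "(\<integral>\<^sup>+x. ennreal ((1 / 2) ^ c (Suc m) (x(m := False))) \<partial>mu) = G"
  proof -
    have "c (Suc m) (x(m := False)) = c m x" for x
      using upd[of x False] by (simp add: c_sum)
    then show ?thesis by (simp add: G_def)
  qed
  also have "ennreal p * (ennreal (1 / 2) * G) + ennreal (1 - p) * G = ennreal (1 - p / 2) * G"
  proof -
    have "ennreal p * (ennreal (1 / 2) * G) + ennreal (1 - p) * G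
        = (ennreal (p * (1 / 2)) + ennreal (1 - p)) * G"
      using p by (simp only: ennreal_mult' distrib_right mult.assoc)
    also have "ennreal (p * (1 / 2)) + ennreal (1 - p) = ennreal (1 - p / 2)"
      using p by (subst ennreal_plus[symmetric]) auto
    finally show ?thesis .
  qed
  also have "\<dots> \<le> ennreal (3 / 4) * ennreal ((3 / 4) ^ m)"
    using p Suc by (intro mult_mono ennreal_leI) (auto simp: G_def c_def)
  also have "\<dots> = ennreal ((3 / 4) ^ Suc m)"
    by (simp flip: ennreal_mult)
  finally show ?case by (simp add: c_def)
qed

text \<open>A Chernoff argument: exponentially weighted moments are summable, so almost everywhere
  \<open>g m x\<close> tends to 0 and is eventually below 1, which forces \<open>c m x\<close> to
  grow linearly in \<open>m\<close>.\<close>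

lemma AE_mu_density_ones:
  "AE x in mu. eventually (\<lambda>m. m / 8 \<le> card {n. x n \<and> n < m}) sequentially"
proof -
  define c where "c m x = card {n. x n \<and> n < m}" for m and x :: "nat \<Rightarrow> bool"
  have [measurable]: "c m \<in> mu \<rightarrow>\<^sub>M count_space UNIV" for m
    unfolding c_def by (rule measurable_card_ones_below)
  \<comment> \<open>The base \<open>11 / 10\<close> satisfies \<open>11 / 10 * 3 / 4 < 1\<close>, which makes the expectations summable, and
    \<open>(11 / 10) ^ 8 \<ge> 2\<close>, which gives density \<open>1 / 8\<close>.\<close>
  define g where "g m x = ennreal ((11 / 10) ^ m) * ennreal ((1 / 2) ^ c m x)" for m x
  have [measurable]: "g m \<in> borel_measurable mu" for m
    unfolding g_def by measurable
  have "(\<integral>\<^sup>+x. g m x \<partial>mu) \<le> ennreal ((33 / 40) ^ m)" for m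
  proof -
    have "(\<integral>\<^sup>+x. g m x \<partial>mu) = ennreal ((11 / 10) ^ m) * (\<integral>\<^sup>+x. ennreal ((1 / 2) ^ c m x) \<partial>mu)"
      unfolding g_def by (rule nn_integral_cmult) measurable
    also have "\<dots> \<le> ennreal ((11 / 10) ^ m) * ennreal ((3 / 4) ^ m)"
      unfolding c_def by (intro mult_left_mono nn_integral_half_power_ones_le) simp
    also have "\<dots> = ennreal ((33 / 40) ^ m)"
      by (simp flip: ennreal_mult power_mult_distrib)
    finally show ?thesis .
  qed
  then have "(\<Sum>m. \<integral>\<^sup>+x. g m x \<partial>mu) \<le> (\<Sum>m. ennreal ((33 / 40) ^ m))"
    by (intro suminf_le) auto
  also have "\<dots> < \<infinity>"
    by (subst suminf_ennreal2) (auto intro: summable_geometric)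
  finally have "(\<integral>\<^sup>+x. (\<Sum>m. g m x) \<partial>mu) \<noteq> \<infinity>"
    by (subst nn_integral_suminf) auto
  then have "AE x in mu. (\<Sum>m. g m x) \<noteq> \<infinity>"
    by (intro nn_integral_PInf_AE) measurable
  then show ?thesis
  proof eventually_elim
    case (elim x)
    have g: "g m x = ennreal ((11 / 10) ^ m * (1 / 2) ^ c m x)" for m
      by (simp add: g_def flip: ennreal_mult)
    have "summable (\<lambda>m. (11 / 10) ^ m * (1 / 2 :: real) ^ c m x)"
      using elim by (intro summable_suminf_not_top) (auto simp: g)
    then have "(\<lambda>m. (11 / 10) ^ m * (1 / 2 :: real) ^ c m x) \<longlonglongrightarrow> 0"
      by (rule summable_LIMSEQ_zero)
    then have "eventually (\<lambda>m. (11 / 10) ^ m * (1 / 2 :: real) ^ c m x < 1) sequentially"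
      by (rule order_tendstoD) simp
    then show ?case
    proof eventually_elim
      case (elim m)
      have "(2 :: real) ^ m \<le> ((11 / 10) ^ 8) ^ m"
        by (rule power_mono) (simp_all add: eval_nat_numeral)
      also have "\<dots> = ((11 / 10) ^ m) ^ 8"
        by (simp flip: power_mult add: mult.commute)
      also have "\<dots> \<le> (2 ^ c m x) ^ 8"
        using elim by (intro power_mono) (auto simp: power_divide field_simps)
      finally have "(2 :: real) ^ m \<le> 2 ^ (c m x * 8)"
        by (simp add: power_mult)
      then have "m \<le> c m x * 8"
        by (rule power_le_imp_le_exp[rotated]) simp
      then show ?case by (simp add: c_def)
    qed
  qed
qed

text \<open>The weights along an orbit in \<open>inf_ones\<close> are positive, so
  \<open>ennreal\<close> truncates nothing and the value \<open>\<infinity>\<close> of the series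
  means divergence.\<close>

theorem theorem5p2:
  fixes w :: "(nat \<Rightarrow> bool) \<Rightarrow> (nat \<Rightarrow> bool) \<Rightarrow> real"
  assumes "radon_nikodym_cocycle (restrict_space mu inf_ones)
             (orbit_equiv inf_ones least_deletion) w"
  shows "AE x in restrict_space mu inf_ones.
           (\<lambda>k. w x ((least_deletion ^^ k) x)) \<longlonglongrightarrow> 0 \<and>
           (\<Sum>k. ennreal (w x ((least_deletion ^^ k) x))) = \<infinity>"
proof -
  have "AE x in mu. x \<in> inf_ones \<longrightarrow>
      (\<lambda>k. w x ((least_deletion ^^ k) x)) \<longlonglongrightarrow> 0 \<and>
      (\<Sum>k. ennreal (w x ((least_deletion ^^ k) x))) = \<infinity>"
    using cocycle_forward_geodesic[OF assms] AE_mu_nseq_eventually AE_mu_density_ones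
  proof eventually_elim
    case (elim x)
    show ?case
    proof
      assume x: "x \<in> inf_ones"
      then have "infinite {n. x n}" by (simp add: inf_ones_def)
      with elim x show "(\<lambda>k. w x ((least_deletion ^^ k) x)) \<longlonglongrightarrow> 0 \<and>
          (\<Sum>k. ennreal (w x ((least_deletion ^^ k) x))) = \<infinity>"
        using prod_deletion_weight_tendsto_0[of "{n. x n}"]
          suminf_prod_deletion_weight[of "{n. x n}"] by simp
    qed
  qed
  then show ?thesis
    by (subst AE_restrict_space_iff) auto
qed

end
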